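(* Let $0<p<q$ be real numbers, $\lambda=p/q$, and let $(\hat Y_t)_{t\ge0}$ be the continuous-time random walk on $\mathbb N\cup\{0\}$, $\mathbb N=\{1,2,\dots\}$, which from each $x\ge1$ jumps to $x+1$ at rate $p$ and to $x-1$ at rate $q$, and which is absorbed at $0$. Then: (i) The family $(\delta_1\hat T_t,\ t\ge0)$ is monotone: $\delta_1\hat T_s\preccurlyeq\delta_1\hat T_t$ for $0<s\le t<\infty$. (ii) If $\nu$ is a probability measure on $\mathbb N$, then $\delta_1\hat T_t\preccurlyeq\nu\hat T_t$ for all $t\ge0$. (iii) In particular, if $\nu$ is a quasi-stationary distribution, then $\delta_1\hat T_t\preccurlyeq\nu$ for all $t\ge0$. (iv) The Yaglom limit of $\delta_1$ converges to $\nu_{\min}$, i.e. $\lim_{t\to\infty}\delta_1\hat T_t=\nu_{\min}$, where $$\nu_{\min}(x)=\bigl(1-\sqrt\lambda\bigr)^2\,x\,\bigl(\sqrt\lambda\bigr)^{x-1},\qquad x\ge1.$$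
   Context: $\delta_1$ is the probability measure on $\mathbb N$ concentrated at $1$, and $\preccurlyeq$ denotes the stochastic order of probability measures on $\mathbb N$ induced by the usual order. Let $\hat U_t(x,y):=P(\hat Y_t=y\mid\hat Y_0=x)$ be the semigroup of the walk. For a probability measure $\nu$ on $\mathbb N$ and $t\ge0$, $$\nu\hat T_t(y):=\frac{\nu\hat U_t(y)}{1-\nu\hat U_t(0)},\qquad y\in\mathbb N,$$ is the law at time $t$ of the walk started from $\nu$, conditioned on not being absorbed by time $t$. A probability measure $\nu$ on $\mathbb N$ is a quasi-stationary distribution for the walk if $\nu=\nu\hat T_t$ for all $t\ge0$. Limits of measures are pointwise on $\mathbb N$. *)

theory Defs
  imports "HOL-Probability.Probability"
begin

definition trans_prob ::
    "(nat \<Rightarrow> 'a measure) \<Rightarrow> (real \<Rightarrow> 'a \<Rightarrow> nat) \<Rightarrow> real \<Rightarrow> nat \<Rightarrow> nat \<Rightarrow> real" where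
  "trans_prob P Y t x y = \<P>(\<omega> in P x. Y t \<omega> = y)"

text \<open>
  A time-homogeneous continuous-time Markov chain on the type of natural numbers (zero included)
  with rate matrix \<open>Q\<close>, given as a process \<open>Y\<close> on one measurable space with a
  family of laws: \<open>P x\<close> is the law of the chain started from \<open>x\<close>, that is, the
  conditional probability given that \<open>Y 0 = x\<close>. Only times \<open>t \<ge> 0\<close> matter. As the
  state space is discrete, right-continuity says that the path stays for a positive time in each
  state it visits.
\<close>

locale markov_chain_rates =
  fixes Q :: "nat \<Rightarrow> nat \<Rightarrow> real"
    and P :: "nat \<Rightarrow> 'a measure"
    and Y :: "real \<Rightarrow> 'a \<Rightarrow> nat"
  assumes prob_space_law: "prob_space (P x)"
    and same_sets: "sets (P x) = sets (P y)"
    and measurable_process: "0 \<le> t \<Longrightarrow> Y t \<in> measurable (P x) (count_space UNIV)"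
    and right_continuous_paths:
      "\<omega> \<in> space (P x) \<Longrightarrow> 0 \<le> t \<Longrightarrow> continuous (at_right t) (\<lambda>u. Y u \<omega>)"
    and start: "\<P>(\<omega> in P x. Y 0 \<omega> = x) = 1"
    and markov:
      "0 \<le> s \<Longrightarrow> 0 \<le> t \<Longrightarrow> finite J \<Longrightarrow> J \<subseteq> {0..s} \<Longrightarrow>
       \<P>(\<omega> in P x. (\<forall>r\<in>J. Y r \<omega> = a r) \<and> Y s \<omega> = z) > 0 \<Longrightarrow>
       \<P>(\<omega> in P x. Y (s + t) \<omega> = y \<bar> (\<forall>r\<in>J. Y r \<omega> = a r) \<and> Y s \<omega> = z)
         = trans_prob P Y t z y"
    and jump_rates:
      "((\<lambda>h. (trans_prob P Y h x y - (if x = y then 1 else 0)) / h) \<longlongrightarrow> Q x y) (at_right 0)"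

text \<open>The row of the state 0 vanishes, so 0 is absorbing.\<close>

definition walk_rates :: "real \<Rightarrow> real \<Rightarrow> nat \<Rightarrow> nat \<Rightarrow> real" where
  "walk_rates p q x y =
    (if x = 0 then 0
     else if y = x + 1 then p
     else if y = x - 1 then q
     else if y = x then - (p + q)
     else 0)"

definition absorbed_walk ::
    "real \<Rightarrow> real \<Rightarrow> (nat \<Rightarrow> 'a measure) \<Rightarrow> (real \<Rightarrow> 'a \<Rightarrow> nat) \<Rightarrow> bool" where
  "absorbed_walk p q P Y \<longleftrightarrow> markov_chain_rates (walk_rates p q) P Y"

text \<open>
  A probability measure on the positive integers is a \<^typ>\<open>nat pmf\<close> that does not charge 0.
  The conditioned laws and \<open>nu_min\<close> below are given by their mass functions; only the
  values of these at arguments \<open>y \<ge> 1\<close> are meaningful.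
\<close>

definition prob_on_pos :: "nat pmf \<Rightarrow> bool" where
  "prob_on_pos \<nu> \<longleftrightarrow> set_pmf \<nu> \<subseteq> {1..}"

definition evolved ::
    "(nat \<Rightarrow> 'a measure) \<Rightarrow> (real \<Rightarrow> 'a \<Rightarrow> nat) \<Rightarrow> nat pmf \<Rightarrow> real \<Rightarrow> nat \<Rightarrow> real" where
  "evolved P Y \<nu> t y = (\<Sum>\<^sub>\<infinity>x\<in>{1..}. pmf \<nu> x * trans_prob P Y t x y)"

definition conditioned ::
    "(nat \<Rightarrow> 'a measure) \<Rightarrow> (real \<Rightarrow> 'a \<Rightarrow> nat) \<Rightarrow> nat pmf \<Rightarrow> real \<Rightarrow> nat \<Rightarrow> real" where
  "conditioned P Y \<nu> t y = evolved P Y \<nu> t y / (1 - evolved P Y \<nu> t 0)"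

definition quasi_stationary ::
    "(nat \<Rightarrow> 'a measure) \<Rightarrow> (real \<Rightarrow> 'a \<Rightarrow> nat) \<Rightarrow> nat pmf \<Rightarrow> bool" where
  "quasi_stationary P Y \<nu> \<longleftrightarrow>
     prob_on_pos \<nu> \<and> (\<forall>t\<ge>0. \<forall>y\<ge>1. pmf \<nu> y = conditioned P Y \<nu> t y)"

text \<open>
  Stochastic order of two probability mass functions on the positive integers; boundedness of
  the test function makes both sums converge absolutely.
\<close>

definition stoch_le :: "(nat \<Rightarrow> real) \<Rightarrow> (nat \<Rightarrow> real) \<Rightarrow> bool" (infix "\<preceq>\<^sub>s\<^sub>t" 50) where
  "\<mu> \<preceq>\<^sub>s\<^sub>t \<nu> \<longleftrightarrow>
     (\<forall>f :: nat \<Rightarrow> real. mono_on {1..} f \<longrightarrow> bounded (f ` {1..}) \<longrightarrow>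
        (\<Sum>\<^sub>\<infinity>y\<in>{1..}. f y * \<mu> y) \<le> (\<Sum>\<^sub>\<infinity>y\<in>{1..}. f y * \<nu> y))"

definition nu_min :: "real \<Rightarrow> nat \<Rightarrow> real" where
  "nu_min lam x = (1 - sqrt lam)\<^sup>2 * real x * sqrt lam ^ (x - 1)"

end

theory Submission
  imports Defs
begin

text \<open>
  All comparisons are made in the likelihood ratio order, which implies the stochastic order and
  is insensitive to the normalisation by the survival probability. The \<open>2 \<times> 2\<close> minors
  \<open>u x * v y - u y * v x\<close>, \<open>x < y\<close>, of two solutions of the forward equation on the
  positive integers satisfy a linear system with nonnegative off-diagonal coefficients (two
  independent particles killed when they meet), so they stay nonnegative if they are so at time 0.
  Started from the point mass at 1, the walk is initially below every other law, in particular below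
  its own later law; this gives the first three claims.

  For the Yaglom limit, the ratios \<open>U t 1 y / U t 1 1\<close> are nondecreasing in \<open>t\<close> and, by
  comparison with the eigenvector \<open>nu_min\<close>, bounded by \<open>y \<sigma>^(y - 1)\<close> where
  \<open>\<sigma> = sqrt (p / q)\<close>. Hence they converge, and as their derivatives converge too, the limit is
  a nonnegative solution of the eigenvalue equation. Such a solution below the critical eigenvalue
  would oscillate, so the limit is \<open>y \<sigma>^(y - 1)\<close>, and dominated convergence yields the normalisation.
\<close>

section \<open>Minors of solutions of the forward equation\<close>

text \<open>
  Inductively \<open>F t x y\<close> is at least \<open>- C (K t)\<^sup>n / n!\<close>: each step integrates the
  previous lower bound, since all coefficients of the system are nonnegative.
\<close>

lemma nonneg_on_wedge:
  fixes F :: "real \<Rightarrow> nat \<Rightarrow> nat \<Rightarrow> real"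
  assumes ab: "0 \<le> a" "0 \<le> b"
    and deriv: "\<And>t x y. 0 < t \<Longrightarrow> t < T \<Longrightarrow> 0 < x \<Longrightarrow> x < y \<Longrightarrow>
      ((\<lambda>t. F t x y) has_real_derivative
        a * (F t (x + 1) y + F t x (y + 1)) + b * (F t (x - 1) y + F t x (y - 1))) (at t)"
    and cont: "\<And>x y. continuous_on {0..T} (\<lambda>t. F t x y)"
    and bounded: "\<And>t x y. 0 \<le> t \<Longrightarrow> t \<le> T \<Longrightarrow> \<bar>F t x y\<bar> \<le> C"
    and diag: "\<And>t x. F t x x = 0"
    and zero: "\<And>t y. F t 0 y = 0"
    and init: "\<And>x y. 0 < x \<Longrightarrow> x < y \<Longrightarrow> 0 \<le> F 0 x y"
    and t: "0 \<le> t" "t \<le> T" and xy: "x \<le> y"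
  shows "0 \<le> F t x y"
proof -
  \<comment> \<open>The four neighbour terms have total weight \<open>2 * (a + b)\<close>, so
    integrating the lower bound once multiplies it by \<open>K * t / (n + 1)\<close>.\<close>
  define K where "K = 2 * (a + b)"
  have K: "0 \<le> K" using ab by (simp add: K_def)
  have C: "0 \<le> C" using bounded[OF t, of x y] by linarith
  have bound: "- (C * (K * t) ^ n / fact n) \<le> F t x y" if "0 \<le> t" "t \<le> T" "x \<le> y" for n t x y
    using that
  proof (induction n arbitrary: t x y)
    case 0
    then show ?case using bounded[of t x y] by simp
  next
    case (Suc n)
    consider "x = 0 \<or> x = y" | "0 < x" "x < y" using Suc.prems(3) by linarith
    then show ?case
    proof cases
      case 1
      then have "F t x y = 0" using zero diag by auto
      then show ?thesis using C K \<open>0 \<le> t\<close> by simp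
    next
      case 2
      define c where "c = C * K ^ Suc n / fact (Suc n)"
      have nbhd: "- (C * (K * s) ^ n / fact n) \<le> F s x' y'"
        if "0 < s" "s < t" "x' \<le> y'" for s x' y'
        using Suc.IH[of s x' y'] that Suc.prems by simp
      \<comment> \<open>The derivative of the added power is exactly \<open>K\<close> times the
        previous bound and compensates the four neighbours, so the sum is nondecreasing.\<close>
      have "F 0 x y + c * 0 ^ Suc n \<le> F t x y + c * t ^ Suc n"
      proof (rule DERIV_nonneg_imp_increasing_open[OF \<open>0 \<le> t\<close>])
        fix s assume s: "0 < s" "s < t"
        let ?D = "a * (F s (x + 1) y + F s x (y + 1)) + b * (F s (x - 1) y + F s x (y - 1))"
        let ?e = "C * (K * s) ^ n / fact n"
        have "((\<lambda>t. F t x y + c * t ^ Suc n) has_real_derivative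
            ?D + c * (real (Suc n) * s ^ n)) (at s)"
          using s Suc.prems 2
          using DERIV_pow[of "Suc n" s] by (intro DERIV_add deriv DERIV_cmult) auto
        moreover have "0 \<le> ?D + c * (real (Suc n) * s ^ n)"
        proof -
          \<comment> \<open>Moving \<open>x\<close> up or \<open>y\<close> down may reach the
            diagonal but does not leave the closed wedge; hence the induction runs over
            \<open>x \<le> y\<close>.\<close>
          have "a * (- ?e + - ?e) + b * (- ?e + - ?e) \<le> ?D"
            using s 2 ab by (intro add_mono mult_left_mono nbhd) auto
          moreover have "c * (real (Suc n) * s ^ n) = K * ?e"
            by (simp add: c_def power_mult_distrib fact_Suc del: of_nat_Suc)
          moreover have "K * ?e = 2 * (a * ?e) + 2 * (b * ?e)"
            unfolding K_def by (simp only: distrib_right distrib_left mult.assoc)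
          ultimately show ?thesis by (simp only: distrib_left mult_minus_right)
        qed
        ultimately show "\<exists>d. ((\<lambda>t. F t x y + c * t ^ Suc n) has_real_derivative d) (at s) \<and> 0 \<le> d"
          by blast
      next
        show "continuous_on {0..t} (\<lambda>t. F t x y + c * t ^ Suc n)"
          by (intro continuous_intros continuous_on_subset[OF cont]) (use Suc.prems in auto)
      qed
      moreover have "0 \<le> F 0 x y" by (rule init[OF 2])
      ultimately show ?thesis by (simp add: c_def power_mult_distrib mult_ac)
    qed
  qed
  have "(\<lambda>n. (K * t) ^ n / fact n) \<longlonglongrightarrow> 0"
    using summable_LIMSEQ_zero[OF summable_exp[of "K * t"]] by (simp add: field_simps)
  then have "(\<lambda>n. - (C * ((K * t) ^ n / fact n))) \<longlonglongrightarrow> - (C * 0)"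
    by (intro tendsto_intros)
  then show ?thesis
    using bound[OF t xy] by (intro LIMSEQ_le_const2[where a = "F t x y"]) auto
qed

definition minor :: "(nat \<Rightarrow> real) \<Rightarrow> (nat \<Rightarrow> real) \<Rightarrow> nat \<Rightarrow> nat \<Rightarrow> real" where
  "minor u v x y = u x * v y - u y * v x"

text \<open>
  For \<open>a = q\<close>, \<open>b = p\<close>, \<open>c = p + q\<close> this is the forward equation of the walk restricted
  to the positive states; the boundary value 0 at the state 0 expresses the killing there.
\<close>

definition killed_flow :: "real \<Rightarrow> real \<Rightarrow> real \<Rightarrow> (real \<Rightarrow> nat \<Rightarrow> real) \<Rightarrow> bool" where
  "killed_flow a b c u \<longleftrightarrow>
     (\<forall>t. u t 0 = 0) \<and> (\<exists>B. \<forall>t\<ge>0. \<forall>x. \<bar>u t x\<bar> \<le> B) \<and>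
     (\<forall>x. continuous_on {0..} (\<lambda>t. u t x)) \<and>
     (\<forall>t>0. \<forall>x>0. ((\<lambda>t. u t x) has_real_derivative
        a * u t (x + 1) + b * u t (x - 1) - c * u t x) (at t))"

text \<open>
  The minors of two solutions form a two-particle system that is killed on the diagonal, and the
  factor \<open>exp (2 c t)\<close> removes its negative coefficients.
\<close>

lemma minor_nonneg:
  assumes ab: "0 \<le> a" "0 \<le> b" and u: "killed_flow a b c u" and v: "killed_flow a b c v"
    and init: "\<And>x y. 0 < x \<Longrightarrow> x < y \<Longrightarrow> 0 \<le> minor (u 0) (v 0) x y"
    and t: "0 \<le> t" and xy: "x \<le> y"
  shows "0 \<le> minor (u t) (v t) x y"
proof -
  have "\<exists>B. \<forall>t\<ge>0. \<forall>x. \<bar>u t x\<bar> \<le> B" "\<exists>B. \<forall>t\<ge>0. \<forall>x. \<bar>v t x\<bar> \<le> B"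
    using u v by (simp_all only: killed_flow_def)
  then obtain B B' where B: "\<And>t x. 0 \<le> t \<Longrightarrow> \<bar>u t x\<bar> \<le> B"
    and B': "\<And>t x. 0 \<le> t \<Longrightarrow> \<bar>v t x\<bar> \<le> B'" by metis
  have nn: "0 \<le> B" "0 \<le> B'" using B[of 0 0] B'[of 0 0] by auto
  define F where "F t x y = exp (2 * c * t) * minor (u t) (v t) x y" for t x y
  have "0 \<le> F t x y"
  proof (rule nonneg_on_wedge[OF ab, where F = F and T = t and C = "exp (2 * \<bar>c\<bar> * t) * (2 * B * B')"])
    fix s x y assume s: "0 < s" "s < t" "0 < (x::nat)" "x < y"
    define du dv where
      "du z = a * u s (z + 1) + b * u s (z - 1) - c * u s z" and
      "dv z = a * v s (z + 1) + b * v s (z - 1) - c * v s z" for z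
    have d: "((\<lambda>t. u t x) has_real_derivative du x) (at s)"
        "((\<lambda>t. u t y) has_real_derivative du y) (at s)"
        "((\<lambda>t. v t x) has_real_derivative dv x) (at s)"
        "((\<lambda>t. v t y) has_real_derivative dv y) (at s)"
      using u v s by (auto simp: killed_flow_def du_def dv_def)
    have "((\<lambda>t. F t x y) has_real_derivative
        exp (2 * c * s) * (2 * c) * minor (u s) (v s) x y +
        exp (2 * c * s) * (u s x * dv y + v s y * du x - (u s y * dv x + v s x * du y))) (at s)"
      unfolding F_def minor_def
      by (rule derivative_eq_intros d refl | simp)+
    \<comment> \<open>Each particle loses at rate \<open>c\<close>, which the exponential cancels;
      the remaining products regroup into minors at neighbouring pairs.\<close>
    then show "((\<lambda>t. F t x y) has_real_derivative
        a * (F s (x + 1) y + F s x (y + 1)) + b * (F s (x - 1) y + F s x (y - 1))) (at s)"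
      by (rule DERIV_cong) (simp add: F_def minor_def du_def dv_def algebra_simps)
  next
    show "continuous_on {0..t} (\<lambda>t. F t x y)" for x y
      unfolding F_def minor_def using u v
      by (intro continuous_intros continuous_on_subset[of "{0..}" _ "{0..t}"])
         (auto simp: killed_flow_def)
  next
    fix s x y assume s: "0 \<le> s" "s \<le> t"
    have "\<bar>minor (u s) (v s) x y\<bar> \<le> \<bar>u s x\<bar> * \<bar>v s y\<bar> + \<bar>u s y\<bar> * \<bar>v s x\<bar>"
      unfolding minor_def abs_mult[symmetric] by linarith
    also have "\<dots> \<le> B * B' + B * B'"
      using s nn by (intro add_mono mult_mono B B') auto
    finally have "\<bar>minor (u s) (v s) x y\<bar> \<le> 2 * B * B'" by (simp only: mult_2 distrib_right)
    moreover have "c * s \<le> \<bar>c\<bar> * t" using s by (intro mult_mono) auto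
    then have "2 * c * s \<le> 2 * \<bar>c\<bar> * t" by simp
    ultimately show "\<bar>F s x y\<bar> \<le> exp (2 * \<bar>c\<bar> * t) * (2 * B * B')"
      unfolding F_def abs_mult by (intro mult_mono) auto
  next
    show "F s 0 y = 0" for s y using u v by (simp add: F_def minor_def killed_flow_def)
  qed (use t xy init in \<open>auto simp: F_def minor_def\<close>)
  then show ?thesis by (simp add: F_def zero_le_mult_iff)
qed

section \<open>Dominated convergence for sums and the stochastic order\<close>

text \<open>Tannery's theorem, after extension by zero outside \<open>A\<close>. The filter is
  arbitrary because both small times (forward equation) and large times (Yaglom limit)
  occur.\<close>

lemma tendsto_infsum_dominated:
  fixes f :: "'b \<Rightarrow> nat \<Rightarrow> real"
  assumes lim: "\<And>k. k \<in> A \<Longrightarrow> ((\<lambda>n. f n k) \<longlongrightarrow> g k) F"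
    and bound: "eventually (\<lambda>n. \<forall>k\<in>A. \<bar>f n k\<bar> \<le> M k) F"
    and M: "M summable_on A"
  shows "((\<lambda>n. \<Sum>\<^sub>\<infinity>k\<in>A. f n k) \<longlongrightarrow> (\<Sum>\<^sub>\<infinity>k\<in>A. g k)) F"
proof (cases "F = bot")
  case False
  define f' where "f' k n = (if k \<in> A then f n k else 0)" for k n
  define g' where "g' k = (if k \<in> A then g k else 0)" for k
  define M' where "M' k = (if k \<in> A then M k else 0)" for k
  have to_UNIV: "infsum (\<lambda>k. if k \<in> A then h k else 0) UNIV = infsum h A" for h :: "nat \<Rightarrow> real"
    by (rule infsum_cong_neutral) auto
  have to_suminf: "infsum h UNIV = suminf h" if "summable (\<lambda>k. norm (h k))" for h :: "nat \<Rightarrow> real"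
    using norm_summable_imp_has_sum[OF that] that
    by (metis infsumI summable_norm_cancel summable_sums)
  have "M' summable_on UNIV"
    using M summable_on_cong_neutral[of UNIV A M' M] by (auto simp: M'_def)
  then have sM: "summable M'"
    using has_sum_imp_sums[of M'] by (auto simp: summable_on_def sums_iff)
  have ev: "eventually (\<lambda>(k, n). norm (f' k n) \<le> M' k) (at_top \<times>\<^sub>F F)"
  proof -
    have "eventually (\<lambda>n. \<forall>k. norm (f' k n) \<le> M' k) F"
      using bound by eventually_elim (auto simp: f'_def M'_def)
    then show ?thesis
      unfolding eventually_prod_filter
      by (intro exI[of _ "\<lambda>_. True"] exI[of _ "\<lambda>n. \<forall>k. norm (f' k n) \<le> M' k"]) auto
  qed
  have lim': "((\<lambda>n. f' k n) \<longlongrightarrow> g' k) F" for k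
    using lim by (auto simp: f'_def g'_def)
  note T = tannerys_theorem[OF lim' ev sM False]
  have "((\<lambda>n. suminf (\<lambda>k. f' k n)) \<longlongrightarrow> suminf g') F" using T by blast
  moreover have "suminf g' = infsum g A"
    using T to_suminf[of g'] to_UNIV[of g] by (simp add: g'_def[abs_def])
  moreover have "eventually (\<lambda>n. suminf (\<lambda>k. f' k n) = infsum (f n) A) F"
    using conjunct1[OF T]
  proof eventually_elim
    case (elim n)
    then show ?case
      using to_suminf[of "\<lambda>k. f' k n"] to_UNIV[of "f n"] by (simp add: f'_def)
  qed
  ultimately show ?thesis by (simp add: tendsto_cong)
qed auto

lemma has_sum_diff:
  fixes f g :: "'a \<Rightarrow> real"
  assumes "(f has_sum a) A" "(g has_sum b) A"
  shows "((\<lambda>x. f x - g x) has_sum (a - b)) A"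
  using has_sum_add[OF assms(1) has_sum_cmult_right[OF assms(2), of "-1"]] by simp

text \<open>Symmetrisation: swapping \<open>x\<close> and \<open>y\<close> changes the sign of both
  \<open>f y - f x\<close> and the minor, so their product is nonnegative for all pairs. As both
  masses are 1, its double sum collapses to a difference of means.\<close>

lemma stoch_le_of_minor:
  fixes \<mu> \<nu> :: "nat \<Rightarrow> real"
  assumes \<mu>: "(\<mu> has_sum 1) {1..}" "\<And>x. 1 \<le> x \<Longrightarrow> 0 \<le> \<mu> x"
    and \<nu>: "(\<nu> has_sum 1) {1..}" "\<And>x. 1 \<le> x \<Longrightarrow> 0 \<le> \<nu> x"
    and minor: "\<And>x y. 1 \<le> x \<Longrightarrow> x < y \<Longrightarrow> 0 \<le> minor \<mu> \<nu> x y"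
  shows "\<mu> \<preceq>\<^sub>s\<^sub>t \<nu>"
  unfolding stoch_le_def
proof (intro allI impI)
  fix f :: "nat \<Rightarrow> real" assume f: "mono_on {1..} f" and bdd: "bounded (f ` {1..})"
  obtain B where B: "\<And>x. 1 \<le> x \<Longrightarrow> \<bar>f x\<bar> \<le> B"
    using bdd by (auto simp: bounded_iff)
  have summ: "(\<lambda>y. f y * \<rho> y) summable_on {1..}"
    if \<rho>: "(\<rho> has_sum 1) {1..}" "\<And>x. 1 \<le> x \<Longrightarrow> 0 \<le> \<rho> x" for \<rho> :: "nat \<Rightarrow> real"
  proof (rule abs_summable_summable, rule summable_on_comparison_test)
    show "(\<lambda>y. B * \<rho> y) summable_on {1..}"
      using \<rho>(1) by (intro summable_on_cmult_right) (auto simp: summable_on_def)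
    show "norm (f y * \<rho> y) \<le> B * \<rho> y" if "y \<in> {1..}" for y
      using that B \<rho>(2) by (auto simp: abs_mult intro!: mult_right_mono)
  qed auto
  define m n where "m = (\<Sum>\<^sub>\<infinity>y\<in>{1..}. f y * \<mu> y)" and "n = (\<Sum>\<^sub>\<infinity>y\<in>{1..}. f y * \<nu> y)"
  have m: "((\<lambda>y. f y * \<mu> y) has_sum m) {1..}" and n: "((\<lambda>y. f y * \<nu> y) has_sum n) {1..}"
    unfolding m_def n_def using summ[OF \<mu>] summ[OF \<nu>] by auto
  \<comment> \<open>Summing these nonnegative terms over all \<open>x\<close> and \<open>y\<close> gives \<open>2 (n - m)\<close>.\<close>
  have nonneg: "0 \<le> (f y - f x) * minor \<mu> \<nu> x y" if "1 \<le> x" "1 \<le> y" for x y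
  proof (cases x y rule: linorder_cases)
    case less
    then show ?thesis
      using that minor[of x y] mono_onD[OF f, of x y] by simp
  next
    case greater
    have "minor \<mu> \<nu> x y = - minor \<mu> \<nu> y x" by (simp add: minor_def)
    then show ?thesis
      using that greater minor[of y x] mono_onD[OF f, of y x]
      by (simp add: mult_nonpos_nonneg)
  qed simp
  have inner: "0 \<le> n * \<mu> x - m * \<nu> x - f x * \<mu> x + f x * \<nu> x" if "1 \<le> x" for x
  proof -
    have "((\<lambda>y. \<mu> x * (f y * \<nu> y) - \<nu> x * (f y * \<mu> y) - (f x * \<mu> x) * \<nu> y + (f x * \<nu> x) * \<mu> y)
        has_sum (\<mu> x * n - \<nu> x * m - (f x * \<mu> x) * 1 + (f x * \<nu> x) * 1)) {1..}"
      by (intro has_sum_add has_sum_diff has_sum_cmult_right m n \<mu> \<nu>)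
    then have "0 \<le> \<mu> x * n - \<nu> x * m - (f x * \<mu> x) * 1 + (f x * \<nu> x) * 1"
    proof (rule has_sum_nonneg)
      fix y :: nat assume "y \<in> {1..}"
      then show "0 \<le> \<mu> x * (f y * \<nu> y) - \<nu> x * (f y * \<mu> y) - (f x * \<mu> x) * \<nu> y + (f x * \<nu> x) * \<mu> y"
        using nonneg[OF \<open>1 \<le> x\<close>, of y] by (simp add: minor_def algebra_simps)
    qed
    then show ?thesis by (simp add: mult_ac)
  qed
  have "((\<lambda>x. n * \<mu> x - m * \<nu> x - f x * \<mu> x + f x * \<nu> x) has_sum (n * 1 - m * 1 - m + n)) {1..}"
    by (intro has_sum_add has_sum_diff has_sum_cmult_right m n \<mu> \<nu>)
  then have "0 \<le> n * 1 - m * 1 - m + n"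
    by (rule has_sum_nonneg) (use inner in auto)
  then show "(\<Sum>\<^sub>\<infinity>y\<in>{1..}. f y * \<mu> y) \<le> (\<Sum>\<^sub>\<infinity>y\<in>{1..}. f y * \<nu> y)"
    by (simp add: m_def n_def)
qed

text \<open>The flow is autonomous. This allows a law to be compared with its own later law, seen as
  a solution with a different start.\<close>

lemma killed_flow_shift:
  assumes u: "killed_flow a b c u" and r: "0 \<le> r"
  shows "killed_flow a b c (\<lambda>t. u (t + r))"
proof -
  have "\<exists>B. \<forall>t\<ge>0. \<forall>x. \<bar>u t x\<bar> \<le> B"
    using u by (simp only: killed_flow_def)
  then obtain B where B: "\<And>t x. 0 \<le> t \<Longrightarrow> \<bar>u t x\<bar> \<le> B" by metis
  show ?thesis
    unfolding killed_flow_def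
  proof (intro conjI allI impI)
    show "\<exists>B. \<forall>t\<ge>0. \<forall>x. \<bar>u (t + r) x\<bar> \<le> B"
      using B r by (intro exI[of _ B]) simp
    show "continuous_on {0..} (\<lambda>t. u (t + r) x)" for x
      using u r
      by (intro continuous_on_compose2[of "{0..}" "\<lambda>t. u t x" _ "\<lambda>t. t + r"] continuous_intros)
         (auto simp: killed_flow_def)
    fix t :: real and x :: nat assume "0 < t" "0 < x"
    then have "((\<lambda>t. u t x) has_real_derivative
        a * u (t + r) (x + 1) + b * u (t + r) (x - 1) - c * u (t + r) x) (at (t + r))"
      using u r by (simp add: killed_flow_def)
    then show "((\<lambda>t. u (t + r) x) has_real_derivative
        a * u (t + r) (x + 1) + b * u (t + r) (x - 1) - c * u (t + r) x) (at t)"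
      by (rule DERIV_shift[THEN iffD1])
  qed (use u in \<open>simp add: killed_flow_def\<close>)
qed

section \<open>Kolmogorov equations\<close>

context markov_chain_rates
begin

abbreviation U :: "real \<Rightarrow> nat \<Rightarrow> nat \<Rightarrow> real" where
  "U \<equiv> trans_prob P Y"

lemma U_nonneg: "0 \<le> U t x y"
  by (simp add: trans_prob_def)

lemma U_events:
  assumes "0 \<le> t" shows "{\<omega> \<in> space (P x). Y t \<omega> = y} \<in> sets (P x)"
  using measurable_sets[OF measurable_process[OF assms], of "{y}" x]
  by (simp add: vimage_def Int_def conj_commute)

lemma U_has_sum:
  assumes "0 \<le> t" shows "(U t x has_sum 1) UNIV"
proof -
  interpret prob_space "P x" by (rule prob_space_law)
  have "(\<lambda>y. measure (P x) {\<omega> \<in> space (P x). Y t \<omega> = y})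
      sums measure (P x) (\<Union>y. {\<omega> \<in> space (P x). Y t \<omega> = y})"
    using U_events[OF assms] by (intro finite_measure_UNION) (auto simp: disjoint_family_on_def)
  moreover have "(\<Union>y. {\<omega> \<in> space (P x). Y t \<omega> = y}) = space (P x)" by auto
  ultimately have "U t x sums 1"
    by (simp add: trans_prob_def[abs_def] prob_space)
  then show ?thesis by (intro sums_nonneg_imp_has_sum U_nonneg)
qed

lemma U_sum_le_1:
  assumes "0 \<le> t" "finite S" shows "sum (U t x) S \<le> 1"
  using has_sum_mono_neutral[OF has_sum_finite[OF assms(2)] U_has_sum[OF assms(1)]] U_nonneg
  by blast

lemma U_le_1: "0 \<le> t \<Longrightarrow> U t x y \<le> 1"
  using U_sum_le_1[of t "{y}" x] by simp

lemma U_0: "U 0 x y = of_bool (x = y)"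
proof -
  have 1: "U 0 x x = 1" using start by (simp add: trans_prob_def)
  show ?thesis
    using 1 U_sum_le_1[of 0 "{x, y}" x] U_nonneg[of 0 x y] by (cases "x = y") auto
qed

lemma chapman_kolmogorov:
  assumes s: "0 \<le> s" and t: "0 \<le> t"
  shows "((\<lambda>z. U s x z * U t z y) has_sum U (s + t) x y) UNIV"
proof -
  interpret prob_space "P x" by (rule prob_space_law)
  define A where "A z = {\<omega> \<in> space (P x). Y (s + t) \<omega> = y \<and> Y s \<omega> = z}" for z
  have A_eq: "A z = {\<omega> \<in> space (P x). Y (s + t) \<omega> = y} \<inter> {\<omega> \<in> space (P x). Y s \<omega> = z}" for z
    by (auto simp: A_def)
  have A_meas: "A z \<in> sets (P x)" for z
    unfolding A_eq using s t by (intro sets.Int U_events) auto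
  have "(\<lambda>z. measure (P x) (A z)) sums measure (P x) (\<Union>z. A z)"
    using A_meas by (intro finite_measure_UNION) (auto simp: disjoint_family_on_def A_def)
  moreover have "(\<Union>z. A z) = {\<omega> \<in> space (P x). Y (s + t) \<omega> = y}" by (auto simp: A_def)
  moreover have "measure (P x) (A z) = U s x z * U t z y" for z
  \<comment> \<open>\<open>markov\<close> only covers conditioning events of positive probability;
    if \<open>U s x z\<close> vanishes, so does the joint probability.\<close>
  proof (cases "U s x z = 0")
    case True
    have "measure (P x) (A z) \<le> U s x z"
      unfolding trans_prob_def A_eq using s by (intro finite_measure_mono U_events) auto
    then show ?thesis using True measure_nonneg[of "P x" "A z"] by simp
  next
    case False
    then have pos: "0 < U s x z" using U_nonneg[of s x z] by simp
    have "\<P>(\<omega> in P x. Y (s + t) \<omega> = y \<bar> (\<forall>r\<in>{}. Y r \<omega> = 0) \<and> Y s \<omega> = z) = U t z y"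
      by (rule markov[OF s t]) (use pos in \<open>auto simp: trans_prob_def\<close>)
    then show ?thesis
      using False by (simp add: cond_prob_def A_def trans_prob_def field_simps)
  qed
  ultimately have "(\<lambda>z. U s x z * U t z y) sums U (s + t) x y"
    by (simp add: trans_prob_def)
  then show ?thesis by (intro sums_nonneg_imp_has_sum mult_nonneg_nonneg U_nonneg)
qed

text \<open>The truncation error comes from the paths outside \<open>S\<close> at time
  \<open>h\<close>, so it is at most their probability.\<close>

lemma U_step_bounds:
  assumes h: "0 \<le> h" and t: "0 \<le> t" and S: "finite S"
  shows "0 \<le> U (h + t) x y - (\<Sum>z\<in>S. U h x z * U t z y)"
    and "U (h + t) x y - (\<Sum>z\<in>S. U h x z * U t z y) \<le> 1 - (\<Sum>z\<in>S. U h x z)"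
proof -
  have 1: "((\<lambda>z. U h x z * U t z y) has_sum
      (U (h + t) x y - (\<Sum>z\<in>S. U h x z * U t z y))) (UNIV - S)"
    by (intro has_sum_Diff chapman_kolmogorov h t has_sum_finite S) auto
  have 2: "(U h x has_sum (1 - (\<Sum>z\<in>S. U h x z))) (UNIV - S)"
    by (intro has_sum_Diff U_has_sum h has_sum_finite S) auto
  show "0 \<le> U (h + t) x y - (\<Sum>z\<in>S. U h x z * U t z y)"
    by (rule has_sum_nonneg[OF 1]) (simp add: U_nonneg)
  show "U (h + t) x y - (\<Sum>z\<in>S. U h x z * U t z y) \<le> 1 - (\<Sum>z\<in>S. U h x z)"
    by (rule has_sum_mono[OF 1 2]) (simp add: mult_left_le U_le_1 U_nonneg t)
qed

text \<open>Splitting at time \<open>h\<close> by whether the chain is in \<open>x\<close> gives a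
  bound free of \<open>t\<close>, so continuity at time 0 spreads to all times.\<close>

lemma U_diff_le:
  assumes "0 \<le> h" "0 \<le> t"
  shows "\<bar>U (h + t) x y - U t x y\<bar> \<le> 1 - U h x x"
proof -
  have "0 \<le> U (h + t) x y - U h x x * U t x y"
    "U (h + t) x y - U h x x * U t x y \<le> 1 - U h x x"
    using U_step_bounds[OF assms, of "{x}" x y] by simp_all
  moreover have "0 \<le> (1 - U h x x) * U t x y" "(1 - U h x x) * U t x y \<le> 1 - U h x x"
    using U_le_1[OF assms(1), of x x] U_le_1[OF assms(2), of x y] U_nonneg
    by (auto intro: mult_left_le)
  ultimately show ?thesis by (simp add: algebra_simps abs_le_iff)
qed

lemma U_continuous: "continuous_on {0..} (\<lambda>t. U t x y)"
proof -
  \<comment> \<open>A finite diagonal rate forces \<open>U h x x\<close> to tend to 1.\<close>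
  have "((\<lambda>h. (U h x x - 1) / h * h + 1) \<longlongrightarrow> Q x x * 0 + 1) (at_right 0)"
    using jump_rates[of x x] by (intro tendsto_intros) auto
  then have "((\<lambda>h. (U h x x - 1) / h * h + 1) \<longlongrightarrow> 1) (at_right 0)" by simp
  moreover have "eventually (\<lambda>h. (U h x x - 1) / h * h + 1 = U h x x) (at_right 0)"
    by (auto simp: eventually_at_filter)
  ultimately have lim: "((\<lambda>h. U h x x) \<longlongrightarrow> 1) (at_right 0)"
    by (rule Lim_transform_eventually)
  show ?thesis
    unfolding continuous_on_iff
  proof (intro ballI allI impI)
    fix t e :: real assume t: "t \<in> {0..}" and e: "0 < e"
    have "eventually (\<lambda>h. dist (U h x x) 1 < e) (at_right 0)" using lim e by (rule tendstoD)
    then obtain d where d: "0 < d" "\<And>h. 0 < h \<Longrightarrow> h < d \<Longrightarrow> dist (U h x x) 1 < e"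
      unfolding eventually_at_right_field by auto
    have "1 - U h x x < e" if "0 \<le> h" "h < d" for h
      using that d(2)[of h] e U_0[of x x] by (cases "h = 0") (auto simp: dist_real_def)
    note small = this
    have "\<bar>U s x y - U t x y\<bar> < e" if s: "0 \<le> s" "\<bar>s - t\<bar> < d" for s
    proof (cases "t \<le> s")
      case True
      then show ?thesis using U_diff_le[of "s - t" t x y] small[of "s - t"] s t by simp
    next
      case False
      then show ?thesis using U_diff_le[of "t - s" s x y] small[of "t - s"] s t
        by (simp add: abs_minus_commute)
    qed
    then show "\<exists>d>0. \<forall>s\<in>{0..}. dist s t < d \<longrightarrow> dist (U s x y) (U t x y) < e"
      using d(1) by (auto simp: dist_real_def)
  qed
qed

lemma U_continuous_at:
  assumes "0 < t" shows "isCont (\<lambda>t. U t x y) t"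
  using U_continuous[of x y] assms
  by (metis at_within_interior atLeast_iff continuous_on_eq_continuous_within greaterThan_iff
      interior_real_atLeast less_imp_le)

text \<open>
  A two-sided derivative: the left difference quotient at \<open>t\<close> is the right one at
  \<open>t - h\<close>, which \<open>quot\<close> controls uniformly in the time.
\<close>

lemma backward_equation:
  assumes S: "finite S" "x \<in> S" and conservative: "(\<Sum>z\<in>S. Q x z) = 0" and t: "0 < t"
  shows "((\<lambda>t. U t x y) has_real_derivative (\<Sum>z\<in>S. Q x z * U t z y)) (at t)"
proof -
  define r where "r h z = (U h x z - of_bool (x = z)) / h" for h z
  have r: "((\<lambda>h. r h z) \<longlongrightarrow> Q x z) (at_right 0)" for z
    using jump_rates[of x z] by (simp add: r_def of_bool_def)
  have r_sum: "((\<lambda>h. - (\<Sum>z\<in>S. r h z)) \<longlongrightarrow> 0) (at_right 0)"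
  proof -
    have "((\<lambda>h. - (\<Sum>z\<in>S. r h z)) \<longlongrightarrow> - (\<Sum>z\<in>S. Q x z)) (at_right 0)"
      by (intro tendsto_intros r)
    then show ?thesis by (simp add: conservative)
  qed
  \<comment> \<open>This is \<open>U_step_bounds\<close> divided by \<open>h\<close>; the right-hand
    side tends to minus the row sum of \<open>Q\<close> over \<open>S\<close>, which is 0.\<close>
  have quot: "\<bar>(U (h + s) x y - U s x y) / h - (\<Sum>z\<in>S. r h z * U s z y)\<bar> \<le> - (\<Sum>z\<in>S. r h z)"
    if "0 < h" "0 \<le> s" for h s
  proof -
    have *: "(\<Sum>z\<in>S. r h z * w z) = ((\<Sum>z\<in>S. U h x z * w z) - w x) / h" for w
    proof -
      have "(\<Sum>z\<in>S. of_bool (x = z) * w z) = (\<Sum>z\<in>S. if x = z then w z else 0)"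
        by (intro sum.cong) auto
      also have "\<dots> = w x" using S by simp
      finally have "(\<Sum>z\<in>S. U h x z * w z) - w x = (\<Sum>z\<in>S. (U h x z - of_bool (x = z)) * w z)"
        by (simp only: left_diff_distrib sum_subtractf)
      then show ?thesis
        by (simp add: r_def sum_divide_distrib)
    qed
    have "(U (h + s) x y - U s x y) / h - (\<Sum>z\<in>S. r h z * U s z y)
        = (U (h + s) x y - (\<Sum>z\<in>S. U h x z * U s z y)) / h"
      by (simp add: * diff_divide_distrib)
    moreover have "- (\<Sum>z\<in>S. r h z) = (1 - (\<Sum>z\<in>S. U h x z)) / h"
      using *[of "\<lambda>_. 1"] that by (simp add: field_simps)
    ultimately show ?thesis
      using U_step_bounds[of h s S x y] that S by (simp add: divide_right_mono)
  qed
  have lim: "((\<lambda>h. (U (h + s h) x y - U (s h) x y) / h) \<longlongrightarrow> (\<Sum>z\<in>S. Q x z * U t z y)) (at_right 0)"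
    if s: "(s \<longlongrightarrow> t) (at_right 0)" "eventually (\<lambda>h. 0 \<le> s h) (at_right 0)" for s
  proof -
    have "((\<lambda>h. \<Sum>z\<in>S. r h z * U (s h) z y) \<longlongrightarrow> (\<Sum>z\<in>S. Q x z * U t z y)) (at_right 0)"
      by (intro tendsto_intros r isCont_tendsto_compose[OF U_continuous_at[OF t]] s)
    moreover have "((\<lambda>h. (U (h + s h) x y - U (s h) x y) / h - (\<Sum>z\<in>S. r h z * U (s h) z y)) \<longlongrightarrow> 0)
        (at_right 0)"
    proof (rule Lim_null_comparison[OF _ r_sum])
      show "eventually (\<lambda>h. norm ((U (h + s h) x y - U (s h) x y) / h - (\<Sum>z\<in>S. r h z * U (s h) z y))
          \<le> - (\<Sum>z\<in>S. r h z)) (at_right 0)"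
        using s(2) eventually_at_right_less[of "0::real"] by eventually_elim (use quot in auto)
    qed
    ultimately show ?thesis using tendsto_add by fastforce
  qed
  have "eventually (\<lambda>h. h < t) (at_right 0)"
    using t by (auto simp: eventually_at_right_field)
  then have "eventually (\<lambda>h. 0 \<le> t - h) (at_right 0)" by eventually_elim auto
  then have "((\<lambda>h. (U (h + (t - h)) x y - U (t - h) x y) / h) \<longlongrightarrow> (\<Sum>z\<in>S. Q x z * U t z y)) (at_right 0)"
    by (intro lim) (auto intro!: tendsto_eq_intros)
  moreover have reflect: "(U (t + - h) x y - U t x y) / - h = (U (h + (t - h)) x y - U (t - h) x y) / h" for h
    by (cases "h = 0") (simp_all add: field_simps)
  ultimately have "((\<lambda>h. (U (t + h) x y - U t x y) / h) \<longlongrightarrow> (\<Sum>z\<in>S. Q x z * U t z y)) (at_left 0)"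
    unfolding filterlim_at_left_to_right[of _ _ 0] by (simp only: reflect minus_zero)
  moreover have "((\<lambda>h. (U (t + h) x y - U t x y) / h) \<longlongrightarrow> (\<Sum>z\<in>S. Q x z * U t z y)) (at_right 0)"
    using lim[of "\<lambda>_. t"] t by (simp add: add.commute)
  ultimately show ?thesis
    unfolding DERIV_def by (simp add: filterlim_at_split)
qed

end

section \<open>The absorbed walk: forward equation and minors\<close>

locale walk = markov_chain_rates "walk_rates p q" P Y
  for p q :: real and P :: "nat \<Rightarrow> 'a measure" and Y :: "real \<Rightarrow> 'a \<Rightarrow> nat" +
  assumes p_pos: "0 < p" and p_less_q: "p < q"
begin

lemma q_pos: "0 < q"
  using p_pos p_less_q by simp

text \<open>The jump rates are bounded, so the backward equation bounds the time derivative
  uniformly in both states and in time.\<close>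

lemma U_derivative_bounded:
  assumes "0 < t"
  shows "\<exists>d. ((\<lambda>t. U t x y) has_real_derivative d) (at t) \<and> \<bar>d\<bar> \<le> 2 * (p + q)"
proof (cases "x = 0")
  case True
  have "((\<lambda>t. U t x y) has_real_derivative (\<Sum>z\<in>{x}. walk_rates p q x z * U t z y)) (at t)"
    using True assms by (intro backward_equation) (auto simp: walk_rates_def)
  then show ?thesis using True p_pos q_pos by (auto simp: walk_rates_def)
next
  case False
  then obtain k where k: "x = Suc k" using not0_implies_Suc by blast
  let ?S = "{x, x + 1, x - 1}"
  have "((\<lambda>t. U t x y) has_real_derivative (\<Sum>z\<in>?S. walk_rates p q x z * U t z y)) (at t)"
    using k assms by (intro backward_equation) (auto simp: walk_rates_def)
  moreover have "(\<Sum>z\<in>?S. walk_rates p q x z * U t z y)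
      = p * U t (x + 1) y + q * U t (x - 1) y - (p + q) * U t x y"
    using k by (simp add: walk_rates_def algebra_simps)
  moreover have "0 \<le> p * U t (x + 1) y" "p * U t (x + 1) y \<le> p"
    "0 \<le> q * U t (x - 1) y" "q * U t (x - 1) y \<le> q"
    "0 \<le> (p + q) * U t x y" "(p + q) * U t x y \<le> p + q"
    using p_pos q_pos assms U_nonneg U_le_1 by (auto intro!: mult_left_le mult_nonneg_nonneg)
  ultimately show ?thesis
    by (intro exI[of _ "p * U t (x + 1) y + q * U t (x - 1) y - (p + q) * U t x y"]) simp
qed

text \<open>Mean value theorem. Uniformity in the starting state provides the domination in
  \<open>forward_equation\<close>.\<close>

lemma U_near_identity:
  assumes "0 < h" shows "\<bar>U h x y - of_bool (x = y)\<bar> \<le> 2 * (p + q) * h"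
proof -
  have "continuous_on {0..h} (\<lambda>t. U t x y)"
    by (rule continuous_on_subset[OF U_continuous]) auto
  moreover have "(\<lambda>t. U t x y) differentiable (at z)" if "0 < z" for z
    using U_derivative_bounded[OF that] by (auto simp: real_differentiable_def)
  ultimately obtain l z where z: "0 < z" "z < h" and l: "((\<lambda>t. U t x y) has_real_derivative l) (at z)"
    and eq: "U h x y - U 0 x y = (h - 0) * l"
    using MVT[of 0 h "\<lambda>t. U t x y"] assms by blast
  obtain d where "((\<lambda>t. U t x y) has_real_derivative d) (at z)" "\<bar>d\<bar> \<le> 2 * (p + q)"
    using U_derivative_bounded z by blast
  then have "\<bar>l\<bar> \<le> 2 * (p + q)" using DERIV_unique[OF l] by blast
  then show ?thesis using eq assms by (simp add: U_0 abs_mult mult.commute mult_left_mono)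
qed

text \<open>Clearing the entry at 0 gives the forward equation the same form at \<open>y = 1\<close>
  as elsewhere.\<close>

definition alive :: "nat \<Rightarrow> real \<Rightarrow> nat \<Rightarrow> real" where
  "alive x t y = (if y = 0 then 0 else U t x y)"

text \<open>The derivative exists by the backward equation, so only its value as a right derivative
  has to be found. For this the short time comes last in Chapman-Kolmogorov, and the sum over
  intermediate states converges by domination.\<close>

lemma forward_equation:
  assumes t: "0 < t" and y: "0 < y"
  shows "((\<lambda>t. U t x y) has_real_derivative
    q * alive x t (y + 1) + p * alive x t (y - 1) - (p + q) * alive x t y) (at t)"
proof -
  obtain D where D: "((\<lambda>t. U t x y) has_real_derivative D) (at t)"
    using U_derivative_bounded[OF t] by blast
  define r where "r h z = (U h z y - of_bool (z = y)) / h" for h z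
  have "((\<lambda>h. \<Sum>\<^sub>\<infinity>z\<in>UNIV. U t x z * r h z) \<longlongrightarrow> (\<Sum>\<^sub>\<infinity>z\<in>UNIV. U t x z * walk_rates p q z y))
      (at_right 0)"
  proof (rule tendsto_infsum_dominated)
    show "((\<lambda>h. U t x z * r h z) \<longlongrightarrow> U t x z * walk_rates p q z y) (at_right 0)" for z
      unfolding r_def of_bool_def by (intro tendsto_intros jump_rates)
    show "eventually (\<lambda>h. \<forall>z\<in>UNIV. \<bar>U t x z * r h z\<bar> \<le> U t x z * (2 * (p + q))) (at_right 0)"
      using eventually_at_right_less[of "0::real"]
    proof eventually_elim
      case (elim h)
      then have "\<bar>r h z\<bar> \<le> 2 * (p + q)" for z
        using U_near_identity[of h z y] by (simp add: r_def abs_divide pos_divide_le_eq)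
      then show ?case using U_nonneg by (auto simp: abs_mult intro!: mult_left_mono)
    qed
    show "(\<lambda>z. U t x z * (2 * (p + q))) summable_on UNIV"
      using U_has_sum[of t x] t by (intro summable_on_cmult_left) (auto simp: summable_on_def)
  qed
  moreover have "eventually (\<lambda>h. (\<Sum>\<^sub>\<infinity>z\<in>UNIV. U t x z * r h z) = (U (t + h) x y - U t x y) / h) (at_right 0)"
    using eventually_at_right_less[of "0::real"]
  proof eventually_elim
    case (elim h)
    have "((\<lambda>z. U t x z * U h z y) has_sum U (t + h) x y) UNIV"
      using t elim by (intro chapman_kolmogorov) auto
    moreover have "((\<lambda>z. U t x z * of_bool (z = y)) has_sum U t x y) UNIV"
      by (rule has_sum_finite_neutralI[of "{y}"]) auto
    ultimately have "((\<lambda>z. (U t x z * U h z y - U t x z * of_bool (z = y)) / h)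
        has_sum ((U (t + h) x y - U t x y) / h)) UNIV"
      by (intro has_sum_divide_const has_sum_diff)
    then show ?case by (simp add: r_def right_diff_distrib infsumI)
  qed
  ultimately have "((\<lambda>h. (U (t + h) x y - U t x y) / h) \<longlongrightarrow> (\<Sum>\<^sub>\<infinity>z\<in>UNIV. U t x z * walk_rates p q z y))
      (at_right 0)"
    by (rule Lim_transform_eventually)
  moreover have "((\<lambda>h. (U (t + h) x y - U t x y) / h) \<longlongrightarrow> D) (at_right 0)"
    using D unfolding DERIV_def by (simp add: filterlim_at_split)
  ultimately have "D = (\<Sum>\<^sub>\<infinity>z\<in>UNIV. U t x z * walk_rates p q z y)"
    by (intro tendsto_unique[OF trivial_limit_at_right_real])
  also have "\<dots> = (\<Sum>\<^sub>\<infinity>z\<in>{y, y + 1, y - 1}. U t x z * walk_rates p q z y)"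
    by (rule infsum_cong_neutral) (auto simp: walk_rates_def)
  \<comment> \<open>At \<open>y = 1\<close> the neighbour 0 is absorbing and has rate 0 into
    \<open>y\<close>, which matches \<open>alive x t 0 = 0\<close>.\<close>
  also have "\<dots> = q * alive x t (y + 1) + p * alive x t (y - 1) - (p + q) * alive x t y"
    using y by (cases "y = 1") (auto simp: walk_rates_def alive_def algebra_simps)
  finally show ?thesis using D by simp
qed

lemma alive_nonneg: "0 \<le> alive x t y"
  by (simp add: alive_def U_nonneg)

lemma killed_flow_alive: "killed_flow q p (p + q) (\<lambda>t. alive x t)"
  unfolding killed_flow_def
proof (intro conjI allI impI)
  show "\<exists>B. \<forall>t\<ge>0. \<forall>y. \<bar>alive x t y\<bar> \<le> B"
    by (rule exI[of _ 1]) (auto simp: alive_def U_nonneg U_le_1)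
  show "continuous_on {0..} (\<lambda>t. alive x t y)" for y
    by (cases "y = 0") (simp_all add: alive_def U_continuous)
  fix t :: real and y :: nat assume "0 < t" "0 < y"
  then show "((\<lambda>t. alive x t y) has_real_derivative
      q * alive x t (y + 1) + p * alive x t (y - 1) - (p + q) * alive x t y) (at t)"
    using forward_equation[of t y x] by (simp add: alive_def[of x _ y])
qed (simp add: alive_def)

lemma alive_0: "alive x 0 y = of_bool (x = y \<and> 0 < y)"
  by (auto simp: alive_def U_0)

text \<open>At time 0 the subtracted product contains the mass of \<open>alive 1 0\<close> at the
  larger state, which exceeds 1; so it vanishes.\<close>

lemma alive_minor:
  assumes "0 \<le> t" "y \<le> y'" shows "0 \<le> minor (alive 1 t) (alive x t) y y'"
  using p_pos q_pos
  by (intro minor_nonneg[OF _ _ killed_flow_alive killed_flow_alive _ assms])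
     (auto simp: minor_def alive_0)

lemma alive_minor_time:
  assumes st: "0 \<le> s" "s \<le> t" and y: "y \<le> y'"
  shows "0 \<le> minor (alive 1 s) (alive 1 t) y y'"
proof -
  have "killed_flow q p (p + q) (\<lambda>r. alive 1 (r + (t - s)))"
    using st by (intro killed_flow_shift killed_flow_alive) auto
  from minor_nonneg[OF _ _ killed_flow_alive this _ st(1) y, of 1] show ?thesis
    using p_pos q_pos by (simp add: minor_def alive_0 alive_nonneg)
qed

end

section \<open>Stochastic monotonicity\<close>

lemma pmf_nat_has_sum:
  fixes \<nu> :: "nat pmf"
  shows "(pmf \<nu> has_sum 1) UNIV"
proof -
  have "(\<lambda>x. measure \<nu> {x}) sums measure \<nu> (\<Union>x. {x})"
    by (intro measure_pmf.finite_measure_UNION) (auto simp: disjoint_family_on_def)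
  then have "pmf \<nu> sums 1" by (simp add: pmf.rep_eq)
  then show ?thesis by (intro sums_nonneg_imp_has_sum) auto
qed

lemma pmf_pos_has_sum:
  assumes "prob_on_pos \<nu>" shows "(pmf \<nu> has_sum 1) {1..}"
proof -
  have "(pmf \<nu> has_sum (1 - (\<Sum>x\<in>{0}. pmf \<nu> x))) (UNIV - {0})"
    by (intro has_sum_Diff pmf_nat_has_sum has_sum_finite) auto
  moreover have "UNIV - {0} = {1::nat..}" by auto
  moreover have "pmf \<nu> 0 = 0"
    using assms by (auto simp: prob_on_pos_def set_pmf_iff)
  ultimately show ?thesis by simp
qed

context walk
begin

lemma evolved_has_sum:
  assumes "prob_on_pos \<nu>" "0 \<le> t"
  shows "((\<lambda>x. pmf \<nu> x * U t x y) has_sum evolved P Y \<nu> t y) {1..}"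
proof -
  have "(\<lambda>x. pmf \<nu> x * U t x y) summable_on {1..}"
  proof (rule summable_on_comparison_test)
    show "pmf \<nu> summable_on {1..}" using pmf_pos_has_sum[OF assms(1)] by (auto simp: summable_on_def)
  qed (use assms in \<open>auto simp: mult_left_le U_le_1 U_nonneg\<close>)
  then show ?thesis unfolding evolved_def by (rule has_sum_infsum)
qed

lemma evolved_nonneg: "0 \<le> evolved P Y \<nu> t y"
  unfolding evolved_def by (intro infsum_nonneg) (simp add: U_nonneg)

lemma evolved_total:
  assumes "prob_on_pos \<nu>" "0 \<le> t"
  shows "(evolved P Y \<nu> t has_sum 1) UNIV"
proof -
  let ?f = "\<lambda>(x, y). pmf \<nu> x * U t x y"
  have row: "((\<lambda>y. ?f (x, y)) has_sum pmf \<nu> x) UNIV" for x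
    using has_sum_cmult_right[OF U_has_sum[OF assms(2)], of "pmf \<nu> x" x] by simp
  have "?f summable_on ({1..} \<times> UNIV)"
    using row pmf_pos_has_sum[OF assms(1)]
    by (intro summable_on_SigmaI[where g = "pmf \<nu>"]) (auto simp: U_nonneg summable_on_def)
  then have "(?f has_sum 1) ({1..} \<times> UNIV)"
    by (intro has_sum_SigmaI[OF row pmf_pos_has_sum[OF assms(1)]])
  \<comment> \<open>The rows gave the total mass; after exchanging the order of summation the
    columns give \<open>evolved\<close>.\<close>
  then have "((\<lambda>(y, x). ?f (x, y)) has_sum 1) (UNIV \<times> {1..})"
    using has_sum_swap[of ?f "{1..}" UNIV 1] by simp
  then show ?thesis
    by (rule has_sum_SigmaD) (use evolved_has_sum[OF assms] in simp)
qed

lemma evolved_total_pos: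
  assumes "prob_on_pos \<nu>" "0 \<le> t"
  shows "(evolved P Y \<nu> t has_sum (1 - evolved P Y \<nu> t 0)) {1..}"
proof -
  have "(evolved P Y \<nu> t has_sum (1 - (\<Sum>y\<in>{0}. evolved P Y \<nu> t y))) (UNIV - {0})"
    by (intro has_sum_Diff evolved_total assms has_sum_finite) auto
  also have "UNIV - {0} = {1::nat..}" by auto
  finally show ?thesis by simp
qed

text \<open>Dropping the gain terms of the forward equation leaves decay at rate
  \<open>p + q\<close>, so the exponentially weighted return probability is nondecreasing from
  1.\<close>

lemma U_diag_pos:
  assumes t: "0 \<le> t" and x: "0 < x"
  shows "0 < U t x x"
proof -
  have "exp ((p + q) * 0) * U 0 x x \<le> exp ((p + q) * t) * U t x x"
  proof (rule DERIV_nonneg_imp_increasing_open[OF t])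
    fix s assume s: "0 < s" "s < t"
    let ?D = "q * alive x s (x + 1) + p * alive x s (x - 1)"
    have "((\<lambda>s. exp ((p + q) * s) * U s x x) has_real_derivative exp ((p + q) * s) * ?D) (at s)"
      using x by (auto intro!: derivative_eq_intros forward_equation s simp: alive_def algebra_simps)
    moreover have "0 \<le> exp ((p + q) * s) * ?D"
      using p_pos q_pos by (simp add: alive_nonneg)
    ultimately show "\<exists>d. ((\<lambda>s. exp ((p + q) * s) * U s x x) has_real_derivative d) (at s) \<and> 0 \<le> d"
      by blast
  next
    show "continuous_on {0..t} (\<lambda>s. exp ((p + q) * s) * U s x x)"
      by (intro continuous_intros continuous_on_subset[OF U_continuous]) auto
  qed
  then have "0 < exp ((p + q) * t) * U t x x" by (simp add: U_0)
  then show ?thesis by (simp add: zero_less_mult_iff)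
qed

lemma survival_pos:
  assumes "prob_on_pos \<nu>" "0 \<le> t"
  shows "0 < 1 - evolved P Y \<nu> t 0"
proof -
  obtain x where "x \<in> set_pmf \<nu>" using set_pmf_not_empty[of \<nu>] by blast
  then have x: "1 \<le> x" "0 < pmf \<nu> x"
    using assms(1) by (auto simp: prob_on_pos_def pmf_positive_iff)
  have "pmf \<nu> x * U t x x \<le> evolved P Y \<nu> t x"
    using finite_sum_le_has_sum[OF evolved_has_sum[OF assms, of x], of "{x}"] x by (simp add: U_nonneg)
  also have "\<dots> \<le> 1 - evolved P Y \<nu> t 0"
    using finite_sum_le_has_sum[OF evolved_total_pos[OF assms], of "{x}"] x by (simp add: evolved_nonneg)
  finally show ?thesis
    using x U_diag_pos[of t x] assms(2) mult_pos_pos[of "pmf \<nu> x" "U t x x"] by linarith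
qed

lemma conditioned_has_sum:
  assumes "prob_on_pos \<nu>" "0 \<le> t"
  shows "(conditioned P Y \<nu> t has_sum 1) {1..}"
  using has_sum_divide_const[OF evolved_total_pos[OF assms], of "1 - evolved P Y \<nu> t 0"]
    survival_pos[OF assms]
  by (simp add: conditioned_def[abs_def])

text \<open>Minors are bilinear, so the survival probabilities come out as a positive
  factor.\<close>

lemma stoch_le_conditioned:
  assumes \<mu>: "prob_on_pos \<mu>" "0 \<le> s" and \<nu>: "prob_on_pos \<nu>" "0 \<le> t"
    and minor: "\<And>x y. 1 \<le> x \<Longrightarrow> x < y \<Longrightarrow> 0 \<le> minor (evolved P Y \<mu> s) (evolved P Y \<nu> t) x y"
  shows "conditioned P Y \<mu> s \<preceq>\<^sub>s\<^sub>t conditioned P Y \<nu> t"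
proof (rule stoch_le_of_minor)
  show "0 \<le> conditioned P Y \<mu> s x" "0 \<le> conditioned P Y \<nu> t x" for x
    using survival_pos[OF \<mu>] survival_pos[OF \<nu>] by (simp_all add: conditioned_def evolved_nonneg)
  fix x y :: nat assume "1 \<le> x" "x < y"
  have "minor (conditioned P Y \<mu> s) (conditioned P Y \<nu> t) x y
      = minor (evolved P Y \<mu> s) (evolved P Y \<nu> t) x y
        / ((1 - evolved P Y \<mu> s 0) * (1 - evolved P Y \<nu> t 0))"
    by (simp add: minor_def conditioned_def diff_divide_distrib)
  then show "0 \<le> minor (conditioned P Y \<mu> s) (conditioned P Y \<nu> t) x y"
    using minor[OF \<open>1 \<le> x\<close> \<open>x < y\<close>] survival_pos[OF \<mu>] survival_pos[OF \<nu>] by simp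
qed (intro conditioned_has_sum assms)+

lemma prob_on_pos_delta: "prob_on_pos (return_pmf 1)"
  by (simp add: prob_on_pos_def)

lemma evolved_delta: "evolved P Y (return_pmf 1) t y = U t 1 y"
proof -
  have "((\<lambda>x. pmf (return_pmf 1) x * U t x y) has_sum U t 1 y) {1..}"
    by (rule has_sum_finite_neutralI[of "{1}"]) (auto simp: pmf_return)
  then show ?thesis by (simp add: evolved_def infsumI)
qed

lemma conditioned_delta_mono:
  assumes "0 \<le> s" "s \<le> t"
  shows "conditioned P Y (return_pmf 1) s \<preceq>\<^sub>s\<^sub>t conditioned P Y (return_pmf 1) t"
proof (rule stoch_le_conditioned)
  fix x y :: nat assume "1 \<le> x" "x < y"
  then show "0 \<le> minor (evolved P Y (return_pmf 1) s) (evolved P Y (return_pmf 1) t) x y"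
    using alive_minor_time[OF assms, of x y] by (simp add: minor_def evolved_delta[simplified] alive_def)
qed (use assms prob_on_pos_delta in auto)

lemma conditioned_delta_least:
  assumes \<nu>: "prob_on_pos \<nu>" and t: "0 \<le> t"
  shows "conditioned P Y (return_pmf 1) t \<preceq>\<^sub>s\<^sub>t conditioned P Y \<nu> t"
proof (rule stoch_le_conditioned)
  fix y y' :: nat assume y: "1 \<le> y" "y < y'"
  \<comment> \<open>Being linear in its second argument, the minor is the
    \<open>\<nu>\<close>-mixture of those in \<open>alive_minor\<close>.\<close>
  have "((\<lambda>x. U t 1 y * (pmf \<nu> x * U t x y') - U t 1 y' * (pmf \<nu> x * U t x y)) has_sum
      minor (U t 1) (evolved P Y \<nu> t) y y') {1..}"
    unfolding minor_def by (intro has_sum_diff has_sum_cmult_right evolved_has_sum \<nu> t)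
  moreover have "0 \<le> U t 1 y * (pmf \<nu> x * U t x y') - U t 1 y' * (pmf \<nu> x * U t x y)" for x
  proof -
    have "0 \<le> pmf \<nu> x * minor (alive 1 t) (alive x t) y y'"
      using alive_minor[OF t] y by (intro mult_nonneg_nonneg) auto
    then show ?thesis using y by (simp add: minor_def alive_def algebra_simps)
  qed
  ultimately have "0 \<le> minor (U t 1) (evolved P Y \<nu> t) y y'" by (rule has_sum_nonneg)
  then show "0 \<le> minor (evolved P Y (return_pmf 1) t) (evolved P Y \<nu> t) y y'"
    by (simp add: minor_def evolved_delta[simplified])
qed (use \<nu> t prob_on_pos_delta in auto)

end

section \<open>The Yaglom limit\<close>

lemma tendsto_at_top_mono_bounded:
  fixes f :: "real \<Rightarrow> real"
  assumes mono: "\<And>s t. 0 \<le> s \<Longrightarrow> s \<le> t \<Longrightarrow> f s \<le> f t"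
    and bound: "\<And>t. 0 \<le> t \<Longrightarrow> f t \<le> B"
  obtains l where "(f \<longlongrightarrow> l) at_top"
proof -
  \<comment> \<open>Clamping at 0 extends the monotonicity to the whole line.\<close>
  define g where "g t = f (max 0 t)" for t
  have "incseq (\<lambda>n. g (real n))" unfolding g_def by (intro monoI mono) auto
  then obtain l where "(\<lambda>n. g (real n)) \<longlonglongrightarrow> l"
    using bound by (auto simp: g_def intro: incseq_convergent[of "\<lambda>n. g (real n)" B])
  moreover have "mono g" unfolding g_def by (intro monoI mono) auto
  ultimately have "(g \<longlongrightarrow> l) at_top" by (intro tendsto_at_topI_sequentially_real)
  moreover have "eventually (\<lambda>t. g t = f t) at_top"
    using eventually_ge_at_top[of 0] by eventually_elim (simp add: g_def)
  ultimately have "(f \<longlongrightarrow> l) at_top" by (rule Lim_transform_eventually)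
  then show thesis by (rule that)
qed

text \<open>Increments over unit intervals tend to 0 and, by the mean value theorem, are values of
  \<open>f'\<close> at points going to infinity.\<close>

lemma limit_of_derivative_zero:
  fixes f :: "real \<Rightarrow> real"
  assumes f: "(f \<longlongrightarrow> a) at_top" and f': "(f' \<longlongrightarrow> l) at_top"
    and deriv: "\<And>t. 0 < t \<Longrightarrow> (f has_real_derivative f' t) (at t)"
  shows "l = 0"
proof -
  \<comment> \<open>Starting at 1 keeps the closed intervals inside the positive times, where the
    derivative is known.\<close>
  have "\<exists>z>real n + 1. z < real n + 2 \<and> f (real n + 2) - f (real n + 1) = f' z" for n
  proof -
    have "\<exists>z>real n + 1. z < real n + 2 \<and>
        f (real n + 2) - f (real n + 1) = (real n + 2 - (real n + 1)) * f' z"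
      by (rule MVT2) (auto intro: deriv)
    then show ?thesis by simp
  qed
  then obtain z where z: "\<And>n. real n + 1 < z n" "\<And>n. f (real n + 2) - f (real n + 1) = f' (z n)"
    by metis
  have "real n \<le> z n" for n using z(1)[of n] by simp
  then have "filterlim z at_top sequentially"
    by (intro filterlim_at_top_mono[OF filterlim_real_sequentially] always_eventually allI)
  then have "(\<lambda>n. f' (z n)) \<longlonglongrightarrow> l" by (rule filterlim_compose[OF f'])
  moreover have shift: "filterlim (\<lambda>n. real n + c) at_top sequentially" for c
    using filterlim_tendsto_add_at_top[OF tendsto_const filterlim_real_sequentially, of c]
    by (simp add: add.commute)
  have "(\<lambda>n. f (real n + 2) - f (real n + 1)) \<longlonglongrightarrow> a - a"
    by (intro tendsto_diff filterlim_compose[OF f] shift)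
  then have "(\<lambda>n. f' (z n)) \<longlonglongrightarrow> 0" by (simp add: z(2))
  ultimately show ?thesis by (rule LIMSEQ_unique)
qed

text \<open>
  For \<open>c < 2\<close> the solution would be a sine wave and hence change sign; this shows up as
  decreasing increments, which force the sequence to become negative.
\<close>

lemma chebyshev_recurrence_nonneg:
  fixes L :: "nat \<Rightarrow> real"
  assumes L: "L 0 = 0" "L 1 = 1" "\<And>n. L (Suc (Suc n)) = c * L (Suc n) - L n"
    and nonneg: "\<And>n. 0 \<le> L n" and c: "c \<le> 2"
  shows "c = 2" and "L n = real n"
proof -
  define d where "d n = L (Suc n) - L n" for n
  have d_Suc: "d (Suc n) = d n - (2 - c) * L (Suc n)" for n
    by (simp add: d_def L(3) algebra_simps)
  have "decseq d"
    using c nonneg by (intro decseq_SucI) (simp add: d_Suc)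
  have d_nonneg: "0 \<le> d m" for m
  proof (rule ccontr)
    assume neg: "\<not> 0 \<le> d m"
    have "L (m + k) \<le> L m + real k * d m" for k
    proof (induction k)
      case (Suc k)
      then show ?case
        using decseqD[OF \<open>decseq d\<close>, of m "m + k"] by (simp add: d_def algebra_simps)
    qed simp
    moreover obtain k where "L m < real k * - d m"
      using neg reals_Archimedean3[of "- d m"] by auto
    ultimately show False using nonneg[of "m + k"] by (smt (verit) mult_minus_right)
  qed
  show "c = 2"
  proof (rule ccontr)
    assume "c \<noteq> 2"
    then have pos: "0 < 2 - c" using c by simp
    \<comment> \<open>Since \<open>L\<close> stays at least 1, every increment drops by at least
      \<open>2 - c\<close> and finally becomes negative.\<close>
    have ge_1: "1 \<le> L (Suc n)" for n
    proof (induction n)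
      case (Suc n)
      then show ?case using d_nonneg[of "Suc n"] by (simp add: d_def)
    qed (use L in simp)
    have "d n \<le> 1 - real n * (2 - c)" for n
    proof (induction n)
      case (Suc n)
      have "(2 - c) * 1 \<le> (2 - c) * L (Suc n)" using pos ge_1 by (intro mult_left_mono) auto
      then show ?case using Suc by (simp add: d_Suc algebra_simps)
    qed (use L in \<open>simp add: d_def\<close>)
    moreover obtain n where "1 < real n * (2 - c)" using reals_Archimedean3[OF pos] by blast
    ultimately show False using d_nonneg[of n] by (smt (verit))
  qed
  then have "L n = real n \<and> L (Suc n) = real n + 1" by (induction n) (use L in simp_all)
  then show "L n = real n" ..
qed

text \<open>The differentiated geometric series, shifted by one; at \<open>z = sqrt lam\<close> its
  value is the inverse of the constant in \<open>nu_min\<close>.\<close>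

lemma has_sum_weighted_geometric:
  fixes z :: real
  assumes "0 \<le> z" "z < 1"
  shows "((\<lambda>n. real n * z ^ (n - 1)) has_sum (1 / (1 - z)\<^sup>2)) {1..}"
proof -
  have "(\<lambda>n. real (Suc n) * z ^ n) sums (1 / (1 - z)\<^sup>2)"
    using geometric_deriv_sums[of z] assms by simp
  then have "((\<lambda>n. real (Suc n) * z ^ n) has_sum (1 / (1 - z)\<^sup>2)) UNIV"
    using assms by (intro sums_nonneg_imp_has_sum) auto
  then have "((\<lambda>n. real n * z ^ (n - 1)) has_sum (1 / (1 - z)\<^sup>2)) (range Suc)"
    by (subst has_sum_reindex) (auto simp: o_def)
  also have "range Suc = {1..}" by (auto simp: image_iff Suc_le_eq gr0_conv_Suc)
  finally show ?thesis .
qed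

section \<open>Ratios to the mass at 1 and their limit\<close>

context walk
begin

definition \<sigma> :: real where "\<sigma> = sqrt (p / q)"

lemma \<sigma>_pos: "0 < \<sigma>" and \<sigma>_less_1: "\<sigma> < 1" and \<sigma>_square: "q * \<sigma>\<^sup>2 = p"
  using p_pos p_less_q q_pos by (simp_all add: \<sigma>_def)

text \<open>The decay rate \<open>(sqrt q - sqrt p)\<^sup>2\<close> belongs to the eigenvector \<open>nu_min\<close>.\<close>

lemma killed_flow_nu_min:
  "killed_flow q p (p + q)
    (\<lambda>t y. exp (- (p + q - 2 * q * \<sigma>) * t) * (real y * \<sigma> ^ (y - 1)))"
  (is "killed_flow q p (p + q) (\<lambda>t y. exp (- ?\<gamma> * t) * ?m y)")
  unfolding killed_flow_def
proof (intro conjI allI impI)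
  have m_nonneg: "0 \<le> ?m y" for y using \<sigma>_pos by simp
  have m_le: "?m y \<le> 1 / (1 - \<sigma>)\<^sup>2" for y
  proof (cases "y = 0")
    case False
    then have "(\<Sum>z\<in>{y}. ?m z) \<le> 1 / (1 - \<sigma>)\<^sup>2"
      using \<sigma>_pos \<sigma>_less_1
      by (intro finite_sum_le_has_sum[OF has_sum_weighted_geometric]) auto
    then show ?thesis by (simp only: sum.insert sum.empty finite.emptyI empty_iff not_False_eq_True add_0_right)
  qed simp
  \<comment> \<open>The square shows that the decay rate is nonnegative, which bounds the flow in
    time.\<close>
  have "?\<gamma> = q * (1 - \<sigma>)\<^sup>2"
    using \<sigma>_square by (simp add: power2_eq_square algebra_simps)
  then have \<gamma>: "0 \<le> ?\<gamma>" using q_pos by simp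
  show "\<exists>B. \<forall>t\<ge>0. \<forall>y. \<bar>exp (- ?\<gamma> * t) * ?m y\<bar> \<le> B"
  proof (intro exI allI impI)
    fix t :: real and y :: nat assume "0 \<le> t"
    then have "- ?\<gamma> * t \<le> 0" using \<gamma> by (intro mult_nonpos_nonneg) auto
    then have "exp (- ?\<gamma> * t) \<le> 1" by (simp only: exp_le_one_iff)
    then have "exp (- ?\<gamma> * t) * ?m y \<le> 1 * (1 / (1 - \<sigma>)\<^sup>2)"
      using m_le m_nonneg by (intro mult_mono) auto
    then show "\<bar>exp (- ?\<gamma> * t) * ?m y\<bar> \<le> 1 / (1 - \<sigma>)\<^sup>2"
      using m_nonneg[of y] by simp
  qed
  show "continuous_on {0..} (\<lambda>t. exp (- ?\<gamma> * t) * ?m y)" for y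
    by (intro continuous_intros)
  fix t :: real and y :: nat assume "0 < t" "0 < y"
  then obtain k where k: "y = Suc k" using gr0_conv_Suc by blast
  \<comment> \<open>At this decay rate the characteristic polynomial is
    \<open>q * (r - \<sigma>)^2\<close>; the double root produces the factor \<open>real y\<close>,
    which also supplies the boundary value 0.\<close>
  have "q * ?m (y + 1) + p * ?m (y - 1) - (p + q) * ?m y = - ?\<gamma> * ?m y"
  proof (cases k)
    case 0
    then show ?thesis by (simp add: k algebra_simps)
  next
    case (Suc j)
    have "q * ((n + 1) * (s * (s * w))) + r * ((n - 1) * w) - (r + q) * (n * (s * w))
        = - (r + q - 2 * q * s) * (n * (s * w))" if "r = q * s\<^sup>2" for r s n w :: real
      unfolding that by (simp add: power2_eq_square algebra_simps)
    from this[OF \<sigma>_square[symmetric], of "real y" "\<sigma> ^ j"] show ?thesis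
      by (simp add: k Suc algebra_simps)
  qed
  moreover have "q * (e * l) + p * (e * m) - (p + q) * (e * n) = e * (q * l + p * m - (p + q) * n)"
    for e l m n :: real by (simp add: algebra_simps)
  moreover have "((\<lambda>t. exp (g * t) * m) has_real_derivative exp (g * t) * (g * m)) (at t)"
    for g m :: real by (auto intro!: derivative_eq_intros)
  ultimately show "((\<lambda>t. exp (- ?\<gamma> * t) * ?m y) has_real_derivative
      q * (exp (- ?\<gamma> * t) * ?m (y + 1)) + p * (exp (- ?\<gamma> * t) * ?m (y - 1))
      - (p + q) * (exp (- ?\<gamma> * t) * ?m y)) (at t)"
    by (simp only:)
qed simp

text \<open>With the mass at 1 as normalisation instead of the survival probability, monotonicity in
  time is the sign of a single minor.\<close>

definition ratio :: "real \<Rightarrow> nat \<Rightarrow> real" where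
  "ratio t y = alive 1 t y / alive 1 t 1"

lemma alive_1_pos: "0 \<le> t \<Longrightarrow> 0 < alive 1 t 1"
  using U_diag_pos[of t 1] by (simp add: alive_def)

lemma ratio_nonneg: "0 \<le> ratio t y"
  by (simp add: ratio_def alive_nonneg)

lemma ratio_mono:
  assumes "0 \<le> s" "s \<le> t" shows "ratio s y \<le> ratio t y"
proof (cases "y = 0")
  case False
  then show ?thesis
    using alive_minor_time[OF assms, of 1 y] alive_1_pos[of s] alive_1_pos[of t] assms
    by (simp add: ratio_def minor_def field_simps)
qed (simp add: ratio_def alive_def)

text \<open>The point mass at 1 lies below \<open>nu_min\<close> in the likelihood ratio order, and
  the minor at \<open>1\<close> and \<open>y\<close> stays nonnegative; the exponential factor of
  the eigenvector cancels.\<close>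

lemma ratio_le:
  assumes "0 \<le> t" shows "ratio t y \<le> real y * \<sigma> ^ (y - 1)"
proof (cases "y = 0")
  case False
  define e where "e = exp (- (p + q - 2 * q * \<sigma>) * t)"
  have "0 \<le> minor (alive 1 t) (\<lambda>y. e * (real y * \<sigma> ^ (y - 1))) 1 y"
    unfolding e_def
  proof (rule minor_nonneg[OF _ _ killed_flow_alive killed_flow_nu_min _ assms])
    fix x y :: nat assume "0 < x" "x < y"
    then show "0 \<le> minor (alive 1 0)
        (\<lambda>y. exp (- (p + q - 2 * q * \<sigma>) * 0) * (real y * \<sigma> ^ (y - 1))) x y"
      using \<sigma>_pos by (simp add: minor_def alive_0)
  qed (use p_pos q_pos False in auto)
  then have "0 \<le> e * (alive 1 t 1 * (real y * \<sigma> ^ (y - 1)) - alive 1 t y)"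
    by (simp add: minor_def algebra_simps)
  moreover have "0 < e" by (simp add: e_def)
  ultimately have "alive 1 t y \<le> alive 1 t 1 * (real y * \<sigma> ^ (y - 1))"
    by (simp add: zero_le_mult_iff)
  then show ?thesis using alive_1_pos[OF assms] by (simp add: ratio_def pos_divide_le_eq mult.commute)
qed (simp add: ratio_def alive_def)

text \<open>In the quotient the loss rate \<open>p + q\<close> cancels; the limit of
  \<open>ratio t 2\<close> will act as the unknown eigenvalue.\<close>

lemma ratio_derivative:
  assumes t: "0 < t" and y: "0 < y"
  shows "((\<lambda>t. ratio t y) has_real_derivative
    q * ratio t (y + 1) + p * ratio t (y - 1) - q * ratio t 2 * ratio t y) (at t)"
proof -
  let ?d = "\<lambda>y. q * alive 1 t (y + 1) + p * alive 1 t (y - 1) - (p + q) * alive 1 t y"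
  have pos: "0 < alive 1 t 1" using t by (intro alive_1_pos) simp
  have d: "((\<lambda>t. alive 1 t y) has_real_derivative ?d y) (at t)" if "0 < y" for y
    using killed_flow_alive[of 1] t that by (simp add: killed_flow_def)
  have d1: "?d 1 = q * alive 1 t 2 - (p + q) * alive 1 t 1"
    by (simp add: alive_def[of _ _ 0] numeral_2_eq_2)
  have "((\<lambda>t. ratio t y) has_real_derivative
      (?d y * alive 1 t 1 - alive 1 t y * ?d 1) / (alive 1 t 1 * alive 1 t 1)) (at t)"
    unfolding ratio_def using pos by (intro DERIV_divide d y) auto
  moreover have "(?d y * alive 1 t 1 - alive 1 t y * ?d 1) / (alive 1 t 1 * alive 1 t 1)
      = q * ratio t (y + 1) + p * ratio t (y - 1) - q * ratio t 2 * ratio t y"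
    unfolding d1 using pos by (simp add: ratio_def field_simps)
  ultimately show ?thesis by simp
qed

lemma ratio_tendsto: "((\<lambda>t. ratio t y) \<longlongrightarrow> real y * \<sigma> ^ (y - 1)) at_top"
proof -
  have "\<exists>l. ((\<lambda>t. ratio t y) \<longlongrightarrow> l) at_top" for y
    by (rule tendsto_at_top_mono_bounded[of "\<lambda>t. ratio t y"]) (use ratio_mono ratio_le in blast)+
  then obtain M where M: "\<And>y. ((\<lambda>t. ratio t y) \<longlongrightarrow> M y) at_top" by metis
  have M_nonneg: "0 \<le> M y" for y
    by (rule tendsto_lowerbound[OF M]) (simp_all add: ratio_nonneg)
  have M_0: "M 0 = 0"
    using M[of 0] by (simp add: ratio_def alive_def tendsto_const_iff)
  have M_1: "M 1 = 1"
  proof (rule tendsto_unique[OF _ M])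
    have "eventually (\<lambda>t. 1 = ratio t 1) at_top"
      using eventually_ge_at_top[of 0]
      by eventually_elim (use alive_1_pos in \<open>force simp: ratio_def\<close>)
    then show "((\<lambda>t. ratio t 1) \<longlongrightarrow> 1) at_top" by (rule Lim_transform_eventually[OF tendsto_const])
  qed simp
  have M_2: "M 2 \<le> 2 * \<sigma>"
  proof (rule tendsto_upperbound[OF M])
    show "eventually (\<lambda>t. ratio t 2 \<le> 2 * \<sigma>) at_top"
      using eventually_ge_at_top[of 0] by eventually_elim (use ratio_le[of _ 2] in simp)
  qed simp
  \<comment> \<open>Convergence of all ratios makes their derivatives converge, necessarily to 0;
    this turns the differential equation into a recurrence.\<close>
  have rec: "M (y + 2) = M 2 * M (y + 1) - \<sigma>\<^sup>2 * M y" for y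
  proof -
    have "((\<lambda>t. q * ratio t (y + 1 + 1) + p * ratio t (y + 1 - 1) - q * ratio t 2 * ratio t (y + 1)) \<longlongrightarrow>
        q * M (y + 1 + 1) + p * M (y + 1 - 1) - q * M 2 * M (y + 1)) at_top"
      by (intro tendsto_intros M)
    then have "q * M (y + 1 + 1) + p * M (y + 1 - 1) - q * M 2 * M (y + 1) = 0"
      by (rule limit_of_derivative_zero[OF M[of "y + 1"]]) (intro ratio_derivative, auto)
    moreover have "q * (M (y + 2) - (M 2 * M (y + 1) - \<sigma>\<^sup>2 * M y))
        = q * M (y + 1 + 1) + (q * \<sigma>\<^sup>2) * M y - q * M 2 * M (y + 1)"
      by (simp add: algebra_simps numeral_2_eq_2)
    ultimately have "q * (M (y + 2) - (M 2 * M (y + 1) - \<sigma>\<^sup>2 * M y)) = 0"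
      by (simp add: \<sigma>_square)
    then show ?thesis using q_pos by simp
  qed
  \<comment> \<open>Dividing by \<open>\<sigma> ^ (y - 1)\<close> normalises the recurrence to
    \<open>c = M 2 / \<sigma>\<close>, at most 2 by \<open>M_2\<close>. This way of writing the
    quotient avoids truncated subtraction at \<open>y = 0\<close>.\<close>
  define L where "L y = \<sigma> * M y / \<sigma> ^ y" for y
  have "L y = real y"
  proof (rule chebyshev_recurrence_nonneg(2))
    show "L 0 = 0" "L 1 = 1" using M_0 M_1 \<sigma>_pos by (simp_all add: L_def)
    show "L (Suc (Suc n)) = M 2 / \<sigma> * L (Suc n) - L n" for n
      using rec[of n] \<sigma>_pos by (simp add: L_def field_simps power2_eq_square)
    show "0 \<le> L n" for n using M_nonneg \<sigma>_pos by (simp add: L_def)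
    show "M 2 / \<sigma> \<le> 2" using M_2 \<sigma>_pos by (simp add: pos_divide_le_eq)
  qed
  then have "M y = real y * \<sigma> ^ (y - 1)"
    using M_0 \<sigma>_pos by (cases y) (simp_all add: L_def field_simps)
  then show ?thesis using M[of y] by simp
qed

text \<open>The conditioned law is \<open>ratio t\<close> divided by its own total, since
  \<open>alive 1 t 1\<close> cancels; the total converges because the bound in
  \<open>ratio_le\<close> is summable.\<close>

lemma yaglom_limit:
  assumes "1 \<le> y"
  shows "((\<lambda>t. conditioned P Y (return_pmf 1) t y) \<longlongrightarrow> nu_min (p / q) y) at_top"
proof -
  have geo: "((\<lambda>z. real z * \<sigma> ^ (z - 1)) has_sum (1 / (1 - \<sigma>)\<^sup>2)) {1..}"
    using \<sigma>_pos \<sigma>_less_1 by (intro has_sum_weighted_geometric) auto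
  have "((\<lambda>t. \<Sum>\<^sub>\<infinity>z\<in>{1..}. ratio t z) \<longlongrightarrow> (\<Sum>\<^sub>\<infinity>z\<in>{1..}. real z * \<sigma> ^ (z - 1))) at_top"
  proof (rule tendsto_infsum_dominated)
    show "eventually (\<lambda>t. \<forall>z\<in>{1..}. \<bar>ratio t z\<bar> \<le> real z * \<sigma> ^ (z - 1)) at_top"
      using eventually_ge_at_top[of 0] by eventually_elim (use ratio_le ratio_nonneg in auto)
    show "(\<lambda>z. real z * \<sigma> ^ (z - 1)) summable_on {1..}"
      using geo by (auto simp: summable_on_def)
  qed (rule ratio_tendsto)
  then have "((\<lambda>t. \<Sum>\<^sub>\<infinity>z\<in>{1..}. ratio t z) \<longlongrightarrow> 1 / (1 - \<sigma>)\<^sup>2) at_top"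
    by (simp only: infsumI[OF geo])
  then have "((\<lambda>t. ratio t y / (\<Sum>\<^sub>\<infinity>z\<in>{1..}. ratio t z)) \<longlongrightarrow>
      real y * \<sigma> ^ (y - 1) / (1 / (1 - \<sigma>)\<^sup>2)) at_top"
    using \<sigma>_less_1 by (intro tendsto_divide ratio_tendsto) auto
  moreover have "real y * \<sigma> ^ (y - 1) / (1 / (1 - \<sigma>)\<^sup>2) = nu_min (p / q) y"
    by (simp add: nu_min_def \<sigma>_def)
  moreover have "eventually (\<lambda>t. ratio t y / (\<Sum>\<^sub>\<infinity>z\<in>{1..}. ratio t z) = conditioned P Y (return_pmf 1) t y) at_top"
    using eventually_ge_at_top[of 0]
  proof eventually_elim
    case (elim t)
    have "((\<lambda>z. evolved P Y (return_pmf 1) t z / alive 1 t 1)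
        has_sum ((1 - evolved P Y (return_pmf 1) t 0) / alive 1 t 1)) {1..}"
      by (intro has_sum_divide_const evolved_total_pos prob_on_pos_delta elim)
    also have "?this \<longleftrightarrow> (ratio t has_sum ((1 - evolved P Y (return_pmf 1) t 0) / alive 1 t 1)) {1..}"
      by (intro has_sum_cong) (auto simp: ratio_def alive_def evolved_delta[simplified])
    finally have "(\<Sum>\<^sub>\<infinity>z\<in>{1..}. ratio t z) = (1 - evolved P Y (return_pmf 1) t 0) / alive 1 t 1"
      by (rule infsumI)
    then show ?case
      using assms alive_1_pos[OF elim]
      by (simp add: ratio_def conditioned_def alive_def evolved_delta[simplified])
  qed
  ultimately show ?thesis by (simp only: Lim_transform_eventually)
qed

end

theorem corollary8:
  fixes p q :: real
    and P :: "nat \<Rightarrow> 'a measure"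
    and Y :: "real \<Rightarrow> 'a \<Rightarrow> nat"
  assumes "0 < p" and "p < q"
    and "absorbed_walk p q P Y"
  shows
    "(\<forall>s t. 0 < s \<longrightarrow> s \<le> t \<longrightarrow>
        conditioned P Y (return_pmf 1) s \<preceq>\<^sub>s\<^sub>t conditioned P Y (return_pmf 1) t) \<and>
     (\<forall>\<nu>. prob_on_pos \<nu> \<longrightarrow>
        (\<forall>t\<ge>0. conditioned P Y (return_pmf 1) t \<preceq>\<^sub>s\<^sub>t conditioned P Y \<nu> t)) \<and>
     (\<forall>\<nu>. quasi_stationary P Y \<nu> \<longrightarrow>
        (\<forall>t\<ge>0. conditioned P Y (return_pmf 1) t \<preceq>\<^sub>s\<^sub>t pmf \<nu>)) \<and>
     (\<forall>x\<ge>1. ((\<lambda>t. conditioned P Y (return_pmf 1) t x) \<longlongrightarrow> nu_min (p / q) x) at_top)"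
proof -
  interpret walk p q P Y
    using assms by (auto simp: walk_def walk_axioms_def absorbed_walk_def)
  \<comment> \<open>Quasi-stationarity equates the two mass functions at positive arguments only, so
    the sums are matched rather than the functions.\<close>
  have "conditioned P Y (return_pmf 1) t \<preceq>\<^sub>s\<^sub>t pmf \<nu>" if "quasi_stationary P Y \<nu>" "0 \<le> t" for \<nu> t
  proof -
    have "(\<Sum>\<^sub>\<infinity>y\<in>{1..}. f y * conditioned P Y \<nu> t y) = (\<Sum>\<^sub>\<infinity>y\<in>{1..}. f y * pmf \<nu> y)" for f
      using that by (intro infsum_cong) (auto simp: quasi_stationary_def)
    then show ?thesis
      using conditioned_delta_least[of \<nu> t] that by (simp add: stoch_le_def quasi_stationary_def)
  qed
  then show ?thesis
    using conditioned_delta_mono conditioned_delta_least yaglom_limit by simp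
qed

end
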